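(* Let $m,n\ge 1$ be integers and let $F_{m,n}$ be the fan graph, that is, the join of the edgeless graph on $m$ vertices and the path on $n$ vertices. Then $$\mathscr{D}_1(F_{m,n})=\begin{cases}2 & \text{if } m \text{ is odd and } n \text{ is even},\\ 1 & \text{otherwise},\end{cases}\qquad\text{and}\qquad \mathscr{D}_2(F_{m,n})=\begin{cases}0 & \text{if } m \text{ is even and } n \text{ is odd},\\ 1 & \text{otherwise}.\end{cases}$$
   Context: All graphs are finite and simple. For a graph $G$ and a labelling $f: V(G)\to\{0,1\}$, the induced edge labelling is $\overline{f}(xy)=|f(x)-f(y)|$ for $xy\in E(G)$. For $i\in\{0,1\}$, $v_i(f)$ is the number of vertices with label $i$ and $e_i(f)$ is the number of edges with induced label $i$. Put $\Delta_v(f)=|v_0(f)-v_1(f)|$ and $\Delta_e(f)=|e_0(f)-e_1(f)|$. Define $$\mathscr{D}_1(G)=\min_{f}\{\Delta_v(f)+\Delta_e(f)\},\qquad \mathscr{D}_2(G)=\min_{f:\,\Delta_v(f)\le 1}\{\Delta_e(f)\},$$ where the first minimum is over all labellings $f:V(G)\to\{0,1\}$ and the second is over those with $\Delta_v(f)\le 1$. The fan graph $F_{m,n}=\overline{K_m}+P_n$ is the join of the edgeless graph $\overline{K_m}$ on $m$ vertices and the path $P_n$ on $n$ vertices: its vertex set is the disjoint union of the two vertex sets, and its edges are the $n-1$ edges of the path together with all $mn$ pairs consisting of one vertex of $\overline{K_m}$ and one vertex of $P_n$. *)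

theory Defs
  imports Main "HOL-Library.FuncSet"
begin

record 'a graph =
  verts :: "'a set"
  edges :: "'a set set"

definition simple_graph :: "'a graph \<Rightarrow> bool" where
  "simple_graph G \<longleftrightarrow> finite (verts G) \<and> (\<forall>e\<in>edges G. e \<subseteq> verts G \<and> card e = 2)"

text \<open>Labellings are extensional, so that a finite graph has finitely many of them
  and the minima below range over finite sets.\<close>

definition labellings :: "'a graph \<Rightarrow> ('a \<Rightarrow> int) set" where
  "labellings G = (verts G \<rightarrow>\<^sub>E {0, 1})"

definition induced_label :: "('a \<Rightarrow> int) \<Rightarrow> 'a set \<Rightarrow> int" where
  "induced_label f e = (THE k. \<exists>x y. e = {x, y} \<and> k = \<bar>f x - f y\<bar>)"

lemma induced_label_doubleton [simp]: "induced_label f {x, y} = \<bar>f x - f y\<bar>"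
  unfolding induced_label_def
  by (rule the_equality) (auto simp: doubleton_eq_iff abs_minus_commute)

definition v_count :: "'a graph \<Rightarrow> ('a \<Rightarrow> int) \<Rightarrow> int \<Rightarrow> nat" where
  "v_count G f i = card {x \<in> verts G. f x = i}"

definition e_count :: "'a graph \<Rightarrow> ('a \<Rightarrow> int) \<Rightarrow> int \<Rightarrow> nat" where
  "e_count G f i = card {e \<in> edges G. induced_label f e = i}"

definition Delta_v :: "'a graph \<Rightarrow> ('a \<Rightarrow> int) \<Rightarrow> int" where
  "Delta_v G f = \<bar>int (v_count G f 0) - int (v_count G f 1)\<bar>"

definition Delta_e :: "'a graph \<Rightarrow> ('a \<Rightarrow> int) \<Rightarrow> int" where
  "Delta_e G f = \<bar>int (e_count G f 0) - int (e_count G f 1)\<bar>"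

definition D1 :: "'a graph \<Rightarrow> int" where
  "D1 G = Min {Delta_v G f + Delta_e G f | f. f \<in> labellings G}"

definition D2 :: "'a graph \<Rightarrow> int" where
  "D2 G = Min {Delta_e G f | f. f \<in> labellings G \<and> Delta_v G f \<le> 1}"

definition edgeless_graph :: "nat \<Rightarrow> nat graph" where
  "edgeless_graph m = \<lparr>verts = {..<m}, edges = {}\<rparr>"

definition path_graph :: "nat \<Rightarrow> nat graph" where
  "path_graph n = \<lparr>verts = {..<n}, edges = {{i, Suc i} | i. Suc i < n}\<rparr>"

definition graph_join :: "'a graph \<Rightarrow> 'b graph \<Rightarrow> ('a + 'b) graph" where
  "graph_join G H =
    \<lparr>verts = verts G <+> verts H,
     edges = image Inl ` edges G \<union> image Inr ` edges H
       \<union> {{Inl x, Inr y} | x y. x \<in> verts G \<and> y \<in> verts H}\<rparr>"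

definition fan_graph :: "nat \<Rightarrow> nat \<Rightarrow> (nat + nat) graph" where
  "fan_graph m n = graph_join (edgeless_graph m) (path_graph n)"

lemma simple_graph_fan_graph: "simple_graph (fan_graph m n)"
  by (auto simp: simple_graph_def fan_graph_def graph_join_def edgeless_graph_def path_graph_def)

lemma finite_labellings: "simple_graph G \<Longrightarrow> finite (labellings G)"
  by (auto simp: simple_graph_def labellings_def intro!: finite_PiE)

end

theory Submission
  imports Defs
begin

text \<open>
  Replace the labels \<open>0\<close>, \<open>1\<close> by the signs \<open>1\<close>, \<open>-1\<close>. The induced label of an edge then becomes
  the product of the signs of its ends, so both differences turn into sums of signs
  (\<open>Delta_v_eq_sign_sum\<close>, \<open>Delta_e_eq_sign_sum\<close>). For the fan graph, writing \<open>a\<close> and \<open>b\<close> for the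
  sign sums over the edgeless part and over the path, this reads
  \<open>\<Delta>\<^sub>v = |a + b|\<close> and \<open>\<Delta>\<^sub>e = |a b + p|\<close>, where \<open>p\<close> sums the products of consecutive
  signs along the path (\<open>Delta_v_fan_graph\<close>, \<open>Delta_e_fan_graph\<close>).

  A sum of \<open>k\<close> signs has the parity of \<open>k\<close>. Hence \<open>\<Delta>\<^sub>v\<close> has the parity of \<open>m + n\<close> and
  \<open>\<Delta>\<^sub>e\<close> that of the number of edges \<open>m n + (n - 1)\<close>, for every labelling; a
  difference is at least \<open>1\<close> whenever this parity is odd. Both minima are determined by these
  bounds because one labelling attains them simultaneously: the signs \<open>+ - - + + - - +\<close> \<open>\<dots>\<close> along
  the path keep \<open>b\<close> and \<open>p\<close> in \<open>{-1, 0, 1}\<close>, and alternating signs on the edgeless part, with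
  the first one chosen so that \<open>a = -b\<close> when \<open>m\<close> and \<open>n\<close> are odd, keep \<open>a + b\<close> and \<open>a b + p\<close>
  there too (\<open>fan_labelling_attains\<close>).
\<close>

abbreviation vertex_sign :: "('a \<Rightarrow> int) \<Rightarrow> 'a \<Rightarrow> int" where
  "vertex_sign f x \<equiv> 1 - 2 * f x"

lemma card_diff_eq_sign_sum:
  fixes g :: "'a \<Rightarrow> int"
  assumes "finite A" and "\<And>x. x \<in> A \<Longrightarrow> g x \<in> {0, 1}"
  shows "int (card {x \<in> A. g x = 0}) - int (card {x \<in> A. g x = 1}) = (\<Sum>x\<in>A. 1 - 2 * g x)"
proof -
  have count: "int (card {x \<in> A. g x = c}) = (\<Sum>x\<in>A. if g x = c then 1 else 0)" for c
    using assms(1) by (simp add: sum.If_cases Int_def)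
  show ?thesis
    unfolding count sum_subtractf[symmetric]
    using assms(2) by (intro sum.cong) auto
qed

lemma labellings_range: "f \<in> labellings G \<Longrightarrow> x \<in> verts G \<Longrightarrow> f x \<in> {0, 1}"
  unfolding labellings_def by (rule PiE_mem)

lemma Delta_v_eq_sign_sum:
  assumes "simple_graph G" and "f \<in> labellings G"
  shows "Delta_v G f = \<bar>\<Sum>x\<in>verts G. vertex_sign f x\<bar>"
  unfolding Delta_v_def v_count_def
  using assms labellings_range[OF assms(2)]
  by (subst card_diff_eq_sign_sum) (simp_all only: simple_graph_def)

lemma finite_edges:
  assumes "simple_graph G"
  shows "finite (edges G)"
proof (rule finite_subset)
  show "edges G \<subseteq> Pow (verts G)" "finite (Pow (verts G))"
    using assms by (auto simp: simple_graph_def)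
qed

lemma Delta_e_eq_sign_sum:
  assumes "simple_graph G" and "f \<in> labellings G"
  shows "Delta_e G f = \<bar>\<Sum>e\<in>edges G. 1 - 2 * induced_label f e\<bar>"
proof -
  have "induced_label f e \<in> {0, 1}" if e: "e \<in> edges G" for e
  proof -
    obtain x y where xy: "e = {x, y}"
      using assms(1) e by (auto simp: simple_graph_def card_2_iff)
    then have "x \<in> verts G" "y \<in> verts G"
      using assms(1) e by (auto simp: simple_graph_def)
    with labellings_range[OF assms(2)] have "f x \<in> {0, 1}" "f y \<in> {0, 1}"
      by blast+
    then show ?thesis
      using xy by auto
  qed
  then show ?thesis
    unfolding Delta_e_def e_count_def
    by (subst card_diff_eq_sign_sum[OF finite_edges[OF assms(1)]]) auto
qed

lemma edge_sign:
  assumes "f x \<in> {0, 1}" and "f y \<in> {0, 1}"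
  shows "1 - 2 * induced_label f {x, y} = vertex_sign f x * vertex_sign f y"
  using assms by auto

lemma verts_fan_graph: "verts (fan_graph m n) = {..<m} <+> {..<n}"
  by (simp add: fan_graph_def graph_join_def edgeless_graph_def path_graph_def)

lemma edges_fan_graph:
  "edges (fan_graph m n) =
    (\<lambda>i. {Inr i, Inr (Suc i)}) ` {..<n - 1} \<union> (\<lambda>(i, j). {Inl i, Inr j}) ` ({..<m} \<times> {..<n})"
proof -
  have path: "{{i, Suc i} | i. Suc i < n} = (\<lambda>i. {i, Suc i}) ` {..<n - 1}"
    by auto
  show ?thesis
    by (auto simp: fan_graph_def graph_join_def edgeless_graph_def path_graph_def path image_image)
qed

lemma Delta_v_fan_graph:
  assumes "f \<in> labellings (fan_graph m n)"
  shows "Delta_v (fan_graph m n) f =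
    \<bar>(\<Sum>i<m. vertex_sign f (Inl i)) + (\<Sum>j<n. vertex_sign f (Inr j))\<bar>"
  using Delta_v_eq_sign_sum[OF simple_graph_fan_graph assms]
  by (simp add: verts_fan_graph sum.Plus)

text \<open>The join edges contribute all products of a sign from one side with a sign from the
  other, so their sum factors.\<close>

lemma Delta_e_fan_graph:
  assumes "f \<in> labellings (fan_graph m n)"
  shows "Delta_e (fan_graph m n) f =
    \<bar>(\<Sum>i<m. vertex_sign f (Inl i)) * (\<Sum>j<n. vertex_sign f (Inr j))
      + (\<Sum>j<n - 1. vertex_sign f (Inr j) * vertex_sign f (Inr (Suc j)))\<bar>"
proof -
  let ?s = "\<lambda>e. 1 - 2 * induced_label f e"
  let ?P = "(\<lambda>i. {Inr i, Inr (Suc i)}) ` {..<n - 1} :: (nat + nat) set set"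
  let ?J = "(\<lambda>(i, j). {Inl i, Inr j}) ` ({..<m} \<times> {..<n}) :: (nat + nat) set set"
  have l: "f (Inl i) \<in> {0, 1}" if "i < m" for i
    by (rule labellings_range[OF assms]) (use that in \<open>auto simp: verts_fan_graph\<close>)
  have r: "f (Inr j) \<in> {0, 1}" if "j < n" for j
    by (rule labellings_range[OF assms]) (use that in \<open>auto simp: verts_fan_graph\<close>)
  have disj: "?P \<inter> ?J = {}"
    by (auto simp: doubleton_eq_iff)
  have "sum ?s ?P = (\<Sum>j<n - 1. ?s {Inr j, Inr (Suc j)})"
    by (subst sum.reindex) (auto simp: inj_on_def doubleton_eq_iff)
  also have "\<dots> = (\<Sum>j<n - 1. vertex_sign f (Inr j) * vertex_sign f (Inr (Suc j)))"
    by (intro sum.cong refl edge_sign r) auto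
  finally have P: "sum ?s ?P = \<dots>" .
  have "sum ?s ?J = (\<Sum>(i, j)\<in>{..<m} \<times> {..<n}. ?s {Inl i, Inr j})"
    by (subst sum.reindex) (auto simp: inj_on_def doubleton_eq_iff intro!: sum.cong)
  also have "\<dots> = (\<Sum>(i, j)\<in>{..<m} \<times> {..<n}. vertex_sign f (Inl i) * vertex_sign f (Inr j))"
    using l r by (intro sum.cong refl) (auto simp del: induced_label_doubleton simp: edge_sign)
  also have "\<dots> = (\<Sum>i<m. vertex_sign f (Inl i)) * (\<Sum>j<n. vertex_sign f (Inr j))"
    by (simp only: sum.cartesian_product[symmetric] sum_product)
  finally have J: "sum ?s ?J = \<dots>" .
  have "(\<Sum>e\<in>edges (fan_graph m n). ?s e) = sum ?s ?P + sum ?s ?J"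
    unfolding edges_fan_graph by (rule sum.union_disjoint) (use disj in auto)
  then show ?thesis
    unfolding Delta_e_eq_sign_sum[OF simple_graph_fan_graph assms] P J by (simp only: add.commute)
qed

lemma even_sum_of_odd:
  fixes h :: "nat \<Rightarrow> int"
  assumes "\<And>i. i < k \<Longrightarrow> odd (h i)"
  shows "even (\<Sum>i<k. h i) \<longleftrightarrow> even k"
  using assms by (induction k) auto

lemma Delta_v_fan_graph_ge:
  assumes "f \<in> labellings (fan_graph m n)"
  shows "Delta_v (fan_graph m n) f \<ge> (if even (m + n) then 0 else 1)"
proof -
  have "even (Delta_v (fan_graph m n) f) \<longleftrightarrow> even (m + n)"
    unfolding Delta_v_fan_graph[OF assms] by (simp add: even_sum_of_odd)
  moreover have "Delta_v (fan_graph m n) f \<ge> 0"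
    by (simp add: Delta_v_def)
  ultimately show ?thesis
    by (cases "Delta_v (fan_graph m n) f = 0") auto
qed

lemma Delta_e_fan_graph_ge:
  assumes "f \<in> labellings (fan_graph m n)" and "n \<ge> 1"
  shows "Delta_e (fan_graph m n) f \<ge> (if even m \<and> odd n then 0 else 1)"
proof -
  \<comment> \<open>The number of edges \<open>m n + (n - 1)\<close> is even exactly in this case.\<close>
  have "even (Delta_e (fan_graph m n) f) \<longleftrightarrow> even m \<and> odd n"
    unfolding Delta_e_fan_graph[OF assms(1)] using assms(2)
    by (auto simp: even_sum_of_odd)
  moreover have "Delta_e (fan_graph m n) f \<ge> 0"
    by (simp add: Delta_e_def)
  ultimately show ?thesis
    by (cases "Delta_e (fan_graph m n) f = 0") auto
qed

text \<open>The sequence \<open>+ - - +\<close> of period four: its partial sums and the partial sums of its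
  consecutive products \<open>- + - +\<close> \<open>\<dots>\<close> are both bounded by \<open>1\<close> in absolute value.\<close>

definition period4_sign :: "nat \<Rightarrow> int" where
  "period4_sign k = (if even (Suc k div 2) then 1 else -1)"

lemma period4_sign_cases: "period4_sign k = 1 \<or> period4_sign k = -1"
  by (simp add: period4_sign_def)

lemma period4_sign_square: "period4_sign k * period4_sign k = 1"
  by (simp add: period4_sign_def)

lemma period4_sign_Suc:
  "period4_sign (Suc k) = (if even k then - period4_sign k else period4_sign k)"
  by (auto simp: period4_sign_def elim!: evenE oddE)

text \<open>Expressing the partial sum by the next term is what later allows the edgeless part to
  start with that term and cancel the path.\<close>

lemma sum_period4_sign: "(\<Sum>i<k. period4_sign i) = (if odd k then - period4_sign k else 0)"
  by (induction k) (auto simp: period4_sign_Suc)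

lemma sum_period4_sign_products:
  "(\<Sum>i<k. period4_sign i * period4_sign (Suc i)) = (if odd k then -1 else 0)"
  by (induction k) (auto simp: period4_sign_Suc period4_sign_square)

lemma sum_alternating: "(\<Sum>i<k. c * (-1) ^ i) = (if odd k then c else 0 :: int)"
  by (induction k) auto

definition fan_sign :: "nat \<Rightarrow> nat + nat \<Rightarrow> int" where
  "fan_sign n = case_sum (\<lambda>i. period4_sign n * (-1) ^ i) period4_sign"

definition fan_labelling :: "nat \<Rightarrow> nat \<Rightarrow> nat + nat \<Rightarrow> int" where
  "fan_labelling m n = restrict (\<lambda>x. (1 - fan_sign n x) div 2) (verts (fan_graph m n))"

lemma fan_sign_cases: "fan_sign n x = 1 \<or> fan_sign n x = -1"
proof -
  have "(-1) ^ i = (1 :: int) \<or> (-1) ^ i = (-1 :: int)" for i :: nat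
    by (cases "even i") auto
  then show ?thesis
    unfolding fan_sign_def using period4_sign_cases
    by (cases x) (auto, (metis mult_1 mult_minus1 minus_minus)+)
qed

lemma fan_labelling_in_labellings: "fan_labelling m n \<in> labellings (fan_graph m n)"
proof -
  have "(1 - fan_sign n x) div 2 \<in> {0, 1}" for x
    using fan_sign_cases[of n x] by auto
  then show ?thesis
    unfolding labellings_def fan_labelling_def by (intro restrict_PiE_iff[THEN iffD2]) blast
qed

lemma vertex_sign_fan_labelling:
  "x \<in> verts (fan_graph m n) \<Longrightarrow> vertex_sign (fan_labelling m n) x = fan_sign n x"
  unfolding fan_labelling_def using fan_sign_cases[of n x] by auto

lemma fan_labelling_attains:
  assumes "n \<ge> 1"
  shows "Delta_v (fan_graph m n) (fan_labelling m n) = (if even (m + n) then 0 else 1)"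
    and "Delta_e (fan_graph m n) (fan_labelling m n) = (if even m \<and> odd n then 0 else 1)"
proof -
  let ?f = "fan_labelling m n"
  have "(\<Sum>i<m. vertex_sign ?f (Inl i)) = (\<Sum>i<m. period4_sign n * (-1) ^ i)"
    by (intro sum.cong refl, subst vertex_sign_fan_labelling)
      (auto simp: verts_fan_graph fan_sign_def)
  then have a: "(\<Sum>i<m. vertex_sign ?f (Inl i)) = (if odd m then period4_sign n else 0)"
    by (simp only: sum_alternating)
  have r: "vertex_sign ?f (Inr j) = period4_sign j" if "j < n" for j
    using that by (subst vertex_sign_fan_labelling) (auto simp: verts_fan_graph fan_sign_def)
  have "(\<Sum>j<n. vertex_sign ?f (Inr j)) = (\<Sum>j<n. period4_sign j)"
    by (intro sum.cong refl r) auto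
  then have b: "(\<Sum>j<n. vertex_sign ?f (Inr j)) = (if odd n then - period4_sign n else 0)"
    by (simp only: sum_period4_sign)
  have "(\<Sum>j<n - 1. vertex_sign ?f (Inr j) * vertex_sign ?f (Inr (Suc j)))
      = (\<Sum>j<n - 1. period4_sign j * period4_sign (Suc j))"
    by (intro sum.cong refl arg_cong2[where f = "(*)"] r) auto
  then have p: "(\<Sum>j<n - 1. vertex_sign ?f (Inr j) * vertex_sign ?f (Inr (Suc j)))
      = (if even n then -1 else 0)"
    using assms by (simp add: sum_period4_sign_products)
  show "Delta_v (fan_graph m n) ?f = (if even (m + n) then 0 else 1)"
    unfolding Delta_v_fan_graph[OF fan_labelling_in_labellings] a b
    using period4_sign_cases[of n] by auto
  show "Delta_e (fan_graph m n) ?f = (if even m \<and> odd n then 0 else 1)"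
    unfolding Delta_e_fan_graph[OF fan_labelling_in_labellings] a b p
    using period4_sign_square[of n] by auto
qed

theorem theorem8p1:
  fixes m n :: nat
  assumes "m \<ge> 1" and "n \<ge> 1"
  shows "D1 (fan_graph m n) = (if odd m \<and> even n then 2 else 1) \<and>
    D2 (fan_graph m n) = (if even m \<and> odd n then 0 else 1)"
proof
  let ?G = "fan_graph m n" and ?f = "fan_labelling m n"
  let ?v = "if even (m + n) then 0 else 1 :: int"
  let ?e = "if even m \<and> odd n then 0 else 1 :: int"
  note fin = finite_labellings[OF simple_graph_fan_graph[of m n]]
  note f = fan_labelling_in_labellings[of m n] and att = fan_labelling_attains[OF assms(2), of m]
  have "D1 ?G = ?v + ?e"
    unfolding D1_def
  proof (rule Min_eqI)
    show "finite {Delta_v ?G f + Delta_e ?G f | f. f \<in> labellings ?G}"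
      using fin by simp
    show "?v + ?e \<le> y" if "y \<in> {Delta_v ?G f + Delta_e ?G f | f. f \<in> labellings ?G}" for y
      using that add_mono[OF Delta_v_fan_graph_ge Delta_e_fan_graph_ge[OF _ assms(2)]] by blast
    show "?v + ?e \<in> {Delta_v ?G f + Delta_e ?G f | f. f \<in> labellings ?G}"
      using f att by (intro CollectI exI[of _ ?f]) simp
  qed
  then show "D1 ?G = (if odd m \<and> even n then 2 else 1)"
    by auto
  show "D2 ?G = ?e"
    unfolding D2_def
  proof (rule Min_eqI)
    show "finite {Delta_e ?G f | f. f \<in> labellings ?G \<and> Delta_v ?G f \<le> 1}"
      using fin by simp
    show "?e \<le> y" if "y \<in> {Delta_e ?G f | f. f \<in> labellings ?G \<and> Delta_v ?G f \<le> 1}" for y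
      using that Delta_e_fan_graph_ge[OF _ assms(2)] by blast
    show "?e \<in> {Delta_e ?G f | f. f \<in> labellings ?G \<and> Delta_v ?G f \<le> 1}"
      using f att by (intro CollectI exI[of _ ?f]) simp
  qed
qed

end
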